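(* For $n\ge 0$, $$\left|\mathcal{S}^2_n(213)\right|=\left|\mathcal{S}^2_n(312)\right|=\frac{1}{3n+1}\sum_{v=0}^{n}\binom{3n+1}{n-v}\binom{3n+v}{v}.$$
   Context: $\mathcal{S}^2_n(P)$ denotes the set of permutations $\pi\in\mathcal{S}_{3n}$ that avoid every pattern in $P$ (classical pattern avoidance) and satisfy $\pi_{3i+1}<\pi_{3i+2}$ and $\pi_{3i+1}<\pi_{3i+3}$ for all $0\le i<n$. *)

theory Defs
  imports Complex_Main "HOL-Combinatorics.Multiset_Permutations"
begin

text \<open>
  Permutations of \<open>{1..m}\<close> are the words in \<^term>\<open>permutations_of_set {1..m::nat}\<close>, in one-line
  notation. Lists are indexed from 0, so the entry \<open>\<pi>\<^sub>j\<close> is \<open>\<pi> ! (j - 1)\<close>. Patterns are written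
  in the same way: 213 is \<open>[2, 1, 3]\<close>.
\<close>

definition contains_pattern :: "nat list \<Rightarrow> nat list \<Rightarrow> bool" where
  "contains_pattern \<pi> \<sigma> \<longleftrightarrow>
     (\<exists>f :: nat \<Rightarrow> nat.
        strict_mono_on {..<length \<sigma>} f \<and> f ` {..<length \<sigma>} \<subseteq> {..<length \<pi>} \<and>
        (\<forall>i<length \<sigma>. \<forall>j<length \<sigma>. \<pi> ! f i < \<pi> ! f j \<longleftrightarrow> \<sigma> ! i < \<sigma> ! j))"

definition avoids_pattern :: "nat list \<Rightarrow> nat list \<Rightarrow> bool" where
  "avoids_pattern \<pi> \<sigma> \<longleftrightarrow> \<not> contains_pattern \<pi> \<sigma>"

definition S2 :: "nat \<Rightarrow> nat list set \<Rightarrow> nat list set" where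
  "S2 n P =
     {\<pi> \<in> permutations_of_set {1..3 * n}.
        (\<forall>\<sigma>\<in>P. avoids_pattern \<pi> \<sigma>) \<and>
        (\<forall>i<n. \<pi> ! (3 * i) < \<pi> ! (3 * i + 1) \<and> \<pi> ! (3 * i) < \<pi> ! (3 * i + 2))}"

end

theory Submission
  imports Defs "HOL-Library.Sublist" "HOL-Computational_Algebra.Formal_Power_Series"
begin

text \<open>
  In a word avoiding 213 (312) all letters before the minimum exceed (are below) all letters after
  it, so either way the word is determined by its two parts, and the minimum is either the head of
  its block or an unconstrained initial letter. Let \<open>f\<close> be the generating function of the words in
  question, and let \<open>f\<^sub>1\<close>, \<open>f\<^sub>2\<close> allow one or two additional unconstrained initial letters. Then
  \<open>f = 1 + x f f\<^sub>2\<close>, \<open>f\<^sub>1 = f + x f\<^sub>1 f\<^sub>2\<close> and \<open>f\<^sub>2 = f\<^sub>1 + f + x f\<^sub>2 f\<^sub>2\<close>, which gives \<open>f\<^sub>1 = f\<^sup>2\<close>,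
  \<open>f\<^sub>2 = f\<^sup>3 + f\<^sup>2\<close> and \<open>f = 1 + x f\<^sup>3 (1 + f)\<close>. The last equation says \<open>f = \<phi>(x f\<^sup>3)\<close> for
  \<open>\<phi>(y) = (1 + y) / (1 - y)\<close>, hence the coefficients of \<open>f\<close> are \<open>[y\<^sup>n] \<phi>(y)\<^bsup>3n+1\<^esup> / (3n + 1)\<close>.
\<close>

unbundle fps_syntax

section \<open>Length-three patterns as subsequences\<close>

lemma subseq_Cons_conv_nth:
  "subseq (x # xs) ys \<longleftrightarrow> (\<exists>i<length ys. ys ! i = x \<and> subseq xs (drop (Suc i) ys))"
proof
  assume "subseq (x # xs) ys"
  then obtain us vs where "ys = us @ x # vs" "subseq xs vs"
    by (auto dest: list_emb_ConsD)
  then show "\<exists>i<length ys. ys ! i = x \<and> subseq xs (drop (Suc i) ys)"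
    by (intro exI[of _ "length us"]) simp
next
  assume "\<exists>i<length ys. ys ! i = x \<and> subseq xs (drop (Suc i) ys)"
  then obtain i where "i < length ys" "ys ! i = x" "subseq xs (drop (Suc i) ys)"
    by blast
  moreover from this have "ys = take i ys @ x # drop (Suc i) ys"
    using id_take_nth_drop by metis
  ultimately show "subseq (x # xs) ys"
    by (metis list_emb_append2 subseq_Cons2)
qed

lemma subseq3_conv_nth:
  "subseq [a, b, c] w \<longleftrightarrow>
    (\<exists>i j k. i < j \<and> j < k \<and> k < length w \<and> w ! i = a \<and> w ! j = b \<and> w ! k = c)"
proof
  assume "subseq [a, b, c] w"
  then obtain i j k where
      ijk: "i < length w" "w ! i = a" "j < length w - Suc i" "w ! (Suc i + j) = b"
      "k < length w - (Suc i + Suc j)" "w ! (Suc i + (Suc j + k)) = c"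
    by (auto simp: subseq_Cons_conv_nth add_ac)
  then show "\<exists>i j k. i < j \<and> j < k \<and> k < length w \<and> w ! i = a \<and> w ! j = b \<and> w ! k = c"
    by (intro exI[of _ i] exI[of _ "Suc i + j"] exI[of _ "Suc i + (Suc j + k)"]) auto
next
  assume "\<exists>i j k. i < j \<and> j < k \<and> k < length w \<and> w ! i = a \<and> w ! j = b \<and> w ! k = c"
  then obtain i j k where ijk: "i < j" "j < k" "k < length w" "w ! i = a" "w ! j = b" "w ! k = c"
    by blast
  then have "subseq [c] (drop (Suc j) w)"
    by (subst subseq_Cons_conv_nth) (auto intro!: exI[of _ "k - Suc j"])
  then have "subseq [b, c] (drop (Suc i) w)"
    using ijk by (subst subseq_Cons_conv_nth) (auto intro!: exI[of _ "j - Suc i"])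
  then show "subseq [a, b, c] w"
    using ijk by (subst subseq_Cons_conv_nth) (auto intro!: exI[of _ i])
qed

text \<open>An index map on \<open>{..<3}\<close> amounts to three increasing positions, so an
  occurrence can be read off the values of a subsequence. Leaving the comparisons quantified over
  \<open>i\<close> and \<open>j\<close> lets one lemma serve both patterns.\<close>

lemma contains_pattern3:
  "contains_pattern w [p, q, r] \<longleftrightarrow>
    (\<exists>a b c. subseq [a, b, c] w \<and>
      (\<forall>i<3. \<forall>j<3. [a, b, c] ! i < [a, b, c] ! j \<longleftrightarrow> [p, q, r] ! i < [p, q, r] ! j))"
proof
  assume "contains_pattern w [p, q, r]"
  then obtain f where f: "strict_mono_on {..<3} f" "f ` {..<3} \<subseteq> {..<length w}"
    "\<forall>i<3. \<forall>j<3. w ! f i < w ! f j \<longleftrightarrow> [p, q, r] ! i < [p, q, r] ! j"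
    by (auto simp: contains_pattern_def eval_nat_numeral)
  have "f 0 < f 1" "f 1 < f 2"
    by (rule strict_mono_onD[OF f(1)]; simp)+
  moreover have "f 2 < length w"
    using subsetD[OF f(2) imageI[of 2]] by simp
  ultimately have "subseq [w ! f 0, w ! f 1, w ! f 2] w"
    unfolding subseq3_conv_nth by blast
  moreover have "[w ! f 0, w ! f 1, w ! f 2] ! i = w ! f i" if "i < 3" for i
    using that by (auto simp: eval_nat_numeral less_Suc_eq)
  ultimately show "\<exists>a b c. subseq [a, b, c] w \<and>
      (\<forall>i<3. \<forall>j<3. [a, b, c] ! i < [a, b, c] ! j \<longleftrightarrow> [p, q, r] ! i < [p, q, r] ! j)"
    using f(3) by (intro exI[of _ "w ! f 0"] exI[of _ "w ! f 1"] exI[of _ "w ! f 2"]) simp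
next
  assume "\<exists>a b c. subseq [a, b, c] w \<and>
      (\<forall>i<3. \<forall>j<3. [a, b, c] ! i < [a, b, c] ! j \<longleftrightarrow> [p, q, r] ! i < [p, q, r] ! j)"
  then obtain k0 k1 k2 where k: "k0 < k1" "k1 < k2" "k2 < length w"
    and ord: "\<forall>i<3. \<forall>j<3. [w ! k0, w ! k1, w ! k2] ! i < [w ! k0, w ! k1, w ! k2] ! j \<longleftrightarrow>
      [p, q, r] ! i < [p, q, r] ! j"
    by (auto simp: subseq3_conv_nth)
  have len: "length [p, q, r] = 3"
    by simp
  define f where "f i = [k0, k1, k2] ! i" for i
  have "strict_mono_on {..<3} f" "f ` {..<3} \<subseteq> {..<length w}"
    using k by (auto simp: f_def eval_nat_numeral less_Suc_eq intro!: strict_mono_onI)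
  moreover have "w ! f i = [w ! k0, w ! k1, w ! k2] ! i" if "i < 3" for i
    using that by (auto simp: f_def eval_nat_numeral less_Suc_eq)
  ultimately show "contains_pattern w [p, q, r]"
    unfolding contains_pattern_def len using ord by (intro exI[of _ f]) simp
qed

lemma avoids_213: "avoids_pattern w [2, 1, 3] \<longleftrightarrow> (\<forall>a b c. subseq [a, b, c] w \<longrightarrow> \<not> (b < a \<and> a < c))"
proof -
  have "(\<forall>i<3. \<forall>j<3. [a, b, c] ! i < [a, b, c] ! j \<longleftrightarrow> [2, 1, 3] ! i < ([2, 1, 3] ! j :: nat)) \<longleftrightarrow>
      b < a \<and> a < c" for a b c :: nat
    by (auto simp: eval_nat_numeral less_Suc_eq)
  then show ?thesis
    unfolding avoids_pattern_def contains_pattern3 by blast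
qed

lemma avoids_312: "avoids_pattern w [3, 1, 2] \<longleftrightarrow> (\<forall>a b c. subseq [a, b, c] w \<longrightarrow> \<not> (b < c \<and> c < a))"
proof -
  have "(\<forall>i<3. \<forall>j<3. [a, b, c] ! i < [a, b, c] ! j \<longleftrightarrow> [3, 1, 2] ! i < ([3, 1, 2] ! j :: nat)) \<longleftrightarrow>
      b < c \<and> c < a" for a b c :: nat
    by (auto simp: eval_nat_numeral less_Suc_eq)
  then show ?thesis
    unfolding avoids_pattern_def contains_pattern3 by blast
qed

section \<open>Splitting a word at its minimum\<close>

lemma subseq_singleton_left: "subseq [x] ys \<longleftrightarrow> x \<in> set ys"
  by (induction ys) auto

lemma subseq3_append_Cons:
  "subseq [a, b, c] (A @ x # B) \<longleftrightarrow>
     subseq [a, b, c] A \<or> subseq [a, b, c] B \<or>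
     subseq [a, b] A \<and> (c = x \<or> c \<in> set B) \<or>
     a \<in> set A \<and> (b = x \<and> c \<in> set B \<or> subseq [b, c] B) \<or>
     a = x \<and> subseq [b, c] B"
proof -
  have Cons: "subseq (y # ys) (x # B) \<longleftrightarrow> y = x \<and> subseq ys B \<or> subseq (y # ys) B" for y ys
    using subseq_Cons' by auto
  \<comment> \<open>\<open>subseq_append_iff\<close> quantifies over all cuts of the pattern;
    \<open>split\<close> peels off one letter at a time, leaving finitely many explicit
    cuts.\<close>
  have split: "(\<exists>us vs. z # zs = us @ vs \<and> P us vs) \<longleftrightarrow>
      P [] (z # zs) \<or> (\<exists>us vs. zs = us @ vs \<and> P (z # us) vs)"
    for z and zs :: "'a list" and P
    unfolding Cons_eq_append_conv by blast
  show ?thesis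
    unfolding subseq_append_iff split Cons subseq_singleton_left
    by (auto simp: subseq_singleton_left simp del: subseq_Cons2_iff)
qed

lemma subseq2_set: "subseq [y, z] C \<Longrightarrow> y \<in> set C \<and> z \<in> set C"
  by (auto simp: subseq_Cons_conv_nth subseq_singleton_left dest: in_set_dropD)

text \<open>With \<open>x\<close> as the 1 of the pattern, \<open>a < c\<close> on its two sides
  would form 213. Conversely, an occurrence meeting both sides has its 2 in \<open>A\<close> and its
  3 in \<open>B\<close>, against their order, and the minimum \<open>x\<close> can be neither the 2
  nor the 3.\<close>

lemma avoids_213_split:
  assumes min: "\<forall>y\<in>set A \<union> set B. x < y" and dist: "distinct (A @ x # B)"
  shows "avoids_pattern (A @ x # B) [2, 1, 3] \<longleftrightarrow>
    avoids_pattern A [2, 1, 3] \<and> avoids_pattern B [2, 1, 3] \<and> (\<forall>a\<in>set A. \<forall>c\<in>set B. c < a)"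
proof (intro iffI conjI ballI)
  assume avoids: "avoids_pattern (A @ x # B) [2, 1, 3]"
  then show "avoids_pattern A [2, 1, 3]" "avoids_pattern B [2, 1, 3]"
    unfolding avoids_213 subseq3_append_Cons by blast+
  fix a c assume ac: "a \<in> set A" "c \<in> set B"
  then have "subseq [a, x, c] (A @ x # B)"
    by (simp add: subseq3_append_Cons)
  then have "\<not> (x < a \<and> a < c)"
    using avoids unfolding avoids_213 by blast
  moreover have "x < a" "x < c" "a \<noteq> c"
    using ac min dist by auto
  ultimately show "c < a"
    by auto
next
  assume R: "avoids_pattern A [2, 1, 3] \<and> avoids_pattern B [2, 1, 3] \<and> (\<forall>a\<in>set A. \<forall>c\<in>set B. c < a)"
  show "avoids_pattern (A @ x # B) [2, 1, 3]"
    unfolding avoids_213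
  proof (intro allI impI notI)
    fix a b c assume "subseq [a, b, c] (A @ x # B)" and abc: "b < a \<and> a < c"
    \<comment> \<open>The fourth case absorbs all occurrences from \<open>A\<close> to
      \<open>B\<close>, wherever the middle letter lies.\<close>
    then consider "subseq [a, b, c] A" | "subseq [a, b, c] B"
      | "a \<in> set A" "b \<in> set A" "c = x" | "a \<in> set A" "c \<in> set B" | "a = x" "b \<in> set B" "c \<in> set B"
      unfolding subseq3_append_Cons by (blast dest: subseq2_set)
    then show False
      using R[unfolded avoids_213] min abc by cases (blast dest: less_asym)+
  qed
qed

text \<open>As for 213, except that now \<open>a > c\<close> around \<open>x\<close> is forbidden,
  so \<open>A\<close> lies below \<open>B\<close>.\<close>

lemma avoids_312_split:
  assumes min: "\<forall>y\<in>set A \<union> set B. x < y" and dist: "distinct (A @ x # B)"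
  shows "avoids_pattern (A @ x # B) [3, 1, 2] \<longleftrightarrow>
    avoids_pattern A [3, 1, 2] \<and> avoids_pattern B [3, 1, 2] \<and> (\<forall>a\<in>set A. \<forall>c\<in>set B. a < c)"
proof (intro iffI conjI ballI)
  assume avoids: "avoids_pattern (A @ x # B) [3, 1, 2]"
  then show "avoids_pattern A [3, 1, 2]" "avoids_pattern B [3, 1, 2]"
    unfolding avoids_312 subseq3_append_Cons by blast+
  fix a c assume ac: "a \<in> set A" "c \<in> set B"
  then have "subseq [a, x, c] (A @ x # B)"
    by (simp add: subseq3_append_Cons)
  then have "\<not> (x < c \<and> c < a)"
    using avoids unfolding avoids_312 by blast
  moreover have "x < a" "x < c" "a \<noteq> c"
    using ac min dist by auto
  ultimately show "a < c"
    by auto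
next
  assume R: "avoids_pattern A [3, 1, 2] \<and> avoids_pattern B [3, 1, 2] \<and> (\<forall>a\<in>set A. \<forall>c\<in>set B. a < c)"
  show "avoids_pattern (A @ x # B) [3, 1, 2]"
    unfolding avoids_312
  proof (intro allI impI notI)
    fix a b c assume "subseq [a, b, c] (A @ x # B)" and abc: "b < c \<and> c < a"
    then consider "subseq [a, b, c] A" | "subseq [a, b, c] B"
      | "a \<in> set A" "b \<in> set A" "c = x" | "a \<in> set A" "c \<in> set B" | "a = x" "b \<in> set B" "c \<in> set B"
      unfolding subseq3_append_Cons by (blast dest: subseq2_set)
    then show False
      using R[unfolded avoids_312] min abc by cases (blast dest: less_asym)+
  qed
qed

section \<open>The block condition\<close>

text \<open>Recursive form of the condition in \<open>S2\<close>, which can be followed through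
  concatenations. An incomplete last block is unconstrained.\<close>

fun heads_min :: "nat list \<Rightarrow> bool" where
  "heads_min (a # b # c # w) \<longleftrightarrow> a < b \<and> a < c \<and> heads_min w"
| "heads_min _ \<longleftrightarrow> True"

lemma heads_min_conv_nth:
  "length w = 3 * n \<Longrightarrow>
    heads_min w \<longleftrightarrow> (\<forall>i<n. w ! (3 * i) < w ! (3 * i + 1) \<and> w ! (3 * i) < w ! (3 * i + 2))"
proof (induction n arbitrary: w)
  case 0
  then show ?case by simp
next
  case (Suc n)
  then obtain a b c w' where w: "w = a # b # c # w'" and "length w' = 3 * n"
    by (cases w rule: heads_min.cases) auto
  with Suc.IH show ?case
    by (simp add: All_less_Suc2)
qed

text \<open>A minimum cannot be larger than the head of its block, so it must be that head, and
  \<open>A\<close> consists of whole blocks. Its own inequalities then hold automatically, which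
  frees the next two letters; hence \<open>drop 2 B\<close>. The length hypothesis makes the block
  of \<open>x\<close> complete.\<close>

lemma heads_min_append_Cons:
  assumes "\<forall>y\<in>set A \<union> set B. x < y" and "(length A + length B) mod 3 = 2"
  shows "heads_min (A @ x # B) \<longleftrightarrow> length A mod 3 = 0 \<and> heads_min A \<and> heads_min (drop 2 B)"
  using assms
proof (induction A rule: heads_min.induct)
  case (1 a b c w)
  have "(length w + length B) mod 3 = 2"
    using "1.prems"(2) by simp
  moreover have "length (a # b # c # w) mod 3 = length w mod 3"
    by simp
  ultimately show ?case
    using 1 by auto
next
  case "2_1"
  then obtain c d B' where "B = c # d # B'"
    by (cases B rule: heads_min.cases) auto
  with "2_1" show ?case by simp
next
  case ("2_2" a)
  then obtain c B' where "B = c # B'"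
    by (cases B) auto
  with "2_2" show ?case by simp
next
  case ("2_3" a b)
  then show ?case by simp
qed

section \<open>Counting by the position of the minimum\<close>

text \<open>Common ground of both patterns: \<open>R\<close> relates letters before the minimum to
  letters after it. By \<open>interval\<close>, the sizes of the two sides alone determine their
  value sets, which are again intervals.\<close>

locale min_split =
  fixes av :: "nat list \<Rightarrow> bool" and R :: "nat \<Rightarrow> nat \<Rightarrow> bool"
  assumes av_Nil: "av []"
    and av_split: "\<And>A x B. \<forall>y\<in>set A \<union> set B. x < y \<Longrightarrow> distinct (A @ x # B) \<Longrightarrow>
      av (A @ x # B) \<longleftrightarrow> av A \<and> av B \<and> (\<forall>a\<in>set A. \<forall>c\<in>set B. R a c)"
    and interval: "\<And>b p q. \<exists>s t. \<forall>S T.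
      S \<union> T = {b..<b + (p + q)} \<and> card S = p \<and> card T = q \<and> (\<forall>a\<in>S. \<forall>c\<in>T. R a c) \<longleftrightarrow>
      S = {s..<s + p} \<and> T = {t..<t + q}"
begin

text \<open>The start value \<open>b\<close> is arbitrary because the parts of a split word live on
  shifted intervals.\<close>

definition words :: "nat \<Rightarrow> nat \<Rightarrow> (nat list \<Rightarrow> bool) \<Rightarrow> nat list set" where
  "words b m Q = {w \<in> permutations_of_set {b..<b + m}. av w \<and> Q w}"

lemma finite_words: "finite (words b m Q)"
  by (simp add: words_def)

lemma words_iff:
  "w \<in> words b m Q \<longleftrightarrow> distinct w \<and> set w = {b..<b + m} \<and> av w \<and> Q w"
  by (auto simp: words_def permutations_of_set_def)

lemma words_length: "w \<in> words b m Q \<Longrightarrow> length w = m"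
  using distinct_card[of w] by (auto simp: words_iff)

lemma card_words_0: "Q [] \<Longrightarrow> card (words b 0 Q) = 1"
  using av_Nil by (simp add: words_def cong: conj_cong)

lemma append_Cons_in_words_iff:
  "A @ b # B \<in> words b (Suc m) Q \<longleftrightarrow>
    distinct A \<and> distinct B \<and> set A \<inter> set B = {} \<and> set A \<union> set B = {Suc b..<Suc b + m} \<and>
    av A \<and> av B \<and> (\<forall>a\<in>set A. \<forall>c\<in>set B. R a c) \<and> Q (A @ b # B)"
proof (cases "distinct A \<and> distinct B \<and> set A \<inter> set B = {} \<and> set A \<union> set B = {Suc b..<Suc b + m}")
  case True
  then have min: "\<forall>y\<in>set A \<union> set B. b < y"
    by (metis Suc_le_lessD atLeastLessThan_iff)
  then have "b \<notin> set A" "b \<notin> set B"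
    by blast+
  with True have "distinct (A @ b # B)"
    by simp
  moreover have "set (A @ b # B) = {b..<b + Suc m}"
    using True by auto
  ultimately show ?thesis
    using av_split[OF min] True unfolding words_iff by simp
next
  case False
  have "set A \<union> set B = {Suc b..<Suc b + m}"
    if "distinct (A @ b # B)" "set (A @ b # B) = {b..<b + Suc m}"
  proof -
    have "set A \<union> set B = set (A @ b # B) - {b}"
      using that(1) by auto
    also have "\<dots> = {Suc b..<Suc b + m}"
      unfolding that(2) by auto
    finally show ?thesis .
  qed
  with False show ?thesis
    by (auto simp: words_iff)
qed

text \<open>The minimum splits a word, and its position determines which values stand on either side.\<close>

lemma card_words_Suc:
  fixes u v :: "nat \<Rightarrow> real"
  assumes I: "I \<subseteq> {..m}"
    and Q: "\<And>A B. \<forall>y\<in>set A \<union> set B. b < y \<Longrightarrow> length A + length B = m \<Longrightarrow>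
      Q (A @ b # B) \<longleftrightarrow> length A \<in> I \<and> QA (length A) A \<and> QB (length A) B"
    and card_A: "\<And>p s. p \<in> I \<Longrightarrow> real (card (words s p (QA p))) = u p"
    and card_B: "\<And>p s. p \<in> I \<Longrightarrow> real (card (words s (m - p) (QB p))) = v p"
  shows "real (card (words b (Suc m) Q)) = (\<Sum>p\<in>I. u p * v p)"
proof -
  have "\<exists>s t. \<forall>S T. S \<union> T = {Suc b..<Suc b + (p + (m - p))} \<and> card S = p \<and> card T = m - p \<and>
      (\<forall>a\<in>S. \<forall>c\<in>T. R a c) \<longleftrightarrow> S = {s..<s + p} \<and> T = {t..<t + (m - p)}" for p
    by (rule interval)
  \<comment> \<open>The start values depend on \<open>p\<close> only. They are never computed, since
    \<open>card_A\<close> and \<open>card_B\<close> hold for every start. The length stays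
    \<open>p + (m - p)\<close>, which is \<open>m\<close> only for \<open>p \<le> m\<close>, as
    \<open>I\<close> guarantees.\<close>
  then obtain s t where st: "\<And>p S T. S \<union> T = {Suc b..<Suc b + (p + (m - p))} \<and>
      card S = p \<and> card T = m - p \<and> (\<forall>a\<in>S. \<forall>c\<in>T. R a c) \<longleftrightarrow>
      S = {s p..<s p + p} \<and> T = {t p..<t p + (m - p)}"
    by metis
  define P where "P p = words (s p) p (QA p) \<times> words (t p) (m - p) (QB p)" for p
  define glue where "glue = (\<lambda>(A, B). A @ b # B)"
  have P: "set A \<union> set B = {Suc b..<Suc b + m} \<and> (\<forall>a\<in>set A. \<forall>c\<in>set B. R a c) \<and>
      length A = p \<and> length B = m - p \<and> b \<notin> set A \<union> set B"
    if "p \<in> I" "(A, B) \<in> P p" for p A B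
  proof -
    have "set A \<union> set B = {Suc b..<Suc b + (p + (m - p))} \<and> (\<forall>a\<in>set A. \<forall>c\<in>set B. R a c)"
      using st[of "set A" "set B" p] that(2) by (simp add: P_def words_iff)
    moreover have "p + (m - p) = m"
      using that(1) I by auto
    ultimately show ?thesis
      using that(2) words_length by (auto simp: P_def)
  qed
  \<comment> \<open>\<open>b\<close> occurs in neither part, so the cut is unique.\<close>
  have glue: "A = A' \<and> B = B' \<and> p = p'"
    if "p \<in> I" "p' \<in> I" "(A, B) \<in> P p" "(A', B') \<in> P p'" "A @ b # B = A' @ b # B'" for A B A' B' p p'
    using P[OF that(1,3)] P[OF that(2,4)] that(5) by (auto simp: append_Cons_eq_iff)
  have "words b (Suc m) Q = (\<Union>p\<in>I. glue ` P p)"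
  proof (intro equalityI subsetI)
    fix w assume w: "w \<in> words b (Suc m) Q"
    then have "b \<in> set w"
      by (simp add: words_iff)
    then obtain A B where AB: "w = A @ b # B"
      by (meson split_list)
    note parts = w[unfolded AB append_Cons_in_words_iff]
    define p where "p = length A"
    have "card (set A \<union> set B) = card (set A) + card (set B)"
      using parts by (intro card_Un_disjoint) auto
    then have len: "length A + length B = m"
      using parts distinct_card[of A] distinct_card[of B] by simp
    have "\<forall>y\<in>set A \<union> set B. b < y"
      using parts by (metis Suc_le_lessD atLeastLessThan_iff)
    from Q[OF this len] parts have "p \<in> I" "QA p A" "QB p B"
      by (auto simp: p_def)
    moreover have "set A = {s p..<s p + p} \<and> set B = {t p..<t p + (m - p)}"
      unfolding st[symmetric] using parts len by (auto simp: p_def distinct_card)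
    ultimately have "(A, B) \<in> P p"
      using parts by (simp add: P_def words_iff)
    then show "w \<in> (\<Union>p\<in>I. glue ` P p)"
      using \<open>p \<in> I\<close> AB by (force simp: glue_def)
  next
    fix w assume "w \<in> (\<Union>p\<in>I. glue ` P p)"
    then obtain p A B where p: "p \<in> I" "(A, B) \<in> P p" "w = A @ b # B"
      by (auto simp: glue_def)
    note PAB = P[OF p(1,2)]
    have AB: "distinct A" "distinct B" "av A" "av B" "QA p A" "QB p B"
      using p(2) by (auto simp: P_def words_iff)
    have len: "length A + length B = m"
      using PAB p(1) I by auto
    \<comment> \<open>The parts are disjoint by counting: their union has as many values as there
      are letters.\<close>
    have "card (set A \<union> set B) = length A + length B"
      using PAB len by simp
    then have "set A \<inter> set B = {}"
      using AB card_Un_Int[of "set A" "set B"] by (simp add: distinct_card)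
    moreover have "Q (A @ b # B)"
      using Q[of A B] len PAB p(1) AB by auto
    ultimately show "w \<in> words b (Suc m) Q"
      using PAB AB by (simp add: p(3) append_Cons_in_words_iff)
  qed
  moreover have "card (\<Union>p\<in>I. glue ` P p) = (\<Sum>p\<in>I. card (glue ` P p))"
  proof (rule card_UN_disjoint)
    show "finite I"
      using I finite_subset by blast
    show "\<forall>p\<in>I. finite (glue ` P p)"
      by (simp add: P_def finite_words)
    show "\<forall>p\<in>I. \<forall>p'\<in>I. p \<noteq> p' \<longrightarrow> glue ` P p \<inter> glue ` P p' = {}"
    proof (intro ballI impI equals0I)
      fix p p' w assume p: "p \<in> I" "p' \<in> I" "p \<noteq> p'" and "w \<in> glue ` P p \<inter> glue ` P p'"
      then obtain A B A' B' where "(A, B) \<in> P p" "(A', B') \<in> P p'" "A @ b # B = A' @ b # B'"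
        by (auto simp: glue_def)
      then show False
        using glue p by blast
    qed
  qed
  moreover have "card (glue ` P p) = card (P p)" if "p \<in> I" for p
    using glue[OF that that] by (intro card_image inj_onI) (auto simp: glue_def)
  ultimately have "real (card (words b (Suc m) Q)) = (\<Sum>p\<in>I. real (card (P p)))"
    by simp
  also have "\<dots> = (\<Sum>p\<in>I. u p * v p)"
    using card_A card_B by (intro sum.cong) (simp_all add: P_def card_cartesian_product)
  finally show ?thesis .
qed

end

text \<open>Elements of \<open>T\<close> exceed those of \<open>S\<close>, so \<open>S\<close> is
  downward closed in the interval: \<open>a \<in> S\<close> forces
  \<open>{b..a} \<subseteq> S\<close>, and the cardinality bounds \<open>a\<close>.\<close>

lemma lower_part_of_interval:
  fixes S T :: "nat set"
  shows "S \<union> T = {b..<b + (p + q)} \<and> card S = p \<and> card T = q \<and> (\<forall>a\<in>S. \<forall>c\<in>T. a < c) \<longleftrightarrow>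
    S = {b..<b + p} \<and> T = {b + p..<b + p + q}"
proof
  assume ST: "S \<union> T = {b..<b + (p + q)} \<and> card S = p \<and> card T = q \<and> (\<forall>a\<in>S. \<forall>c\<in>T. a < c)"
  have fin: "finite S"
    using ST by (metis finite_Un finite_atLeastLessThan)
  have "S \<subseteq> {b..<b + p}"
  proof
    fix a assume a: "a \<in> S"
    have "{b..a} \<subseteq> S"
    proof
      fix y assume "y \<in> {b..a}"
      moreover have "a \<in> {b..<b + (p + q)}"
        using a ST by blast
      ultimately have "y \<in> S \<union> T"
        using ST by auto
      then show "y \<in> S"
        using a ST \<open>y \<in> {b..a}\<close> by fastforce
    qed
    from card_mono[OF fin this] have "Suc a - b \<le> p"
      using ST by simp
    moreover have "b \<le> a"
      using a ST by auto
    ultimately show "a \<in> {b..<b + p}"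
      by auto
  qed
  then have S: "S = {b..<b + p}"
    using ST by (intro card_subset_eq) auto
  moreover have "S \<inter> T = {}"
    using ST by blast
  then have "T = (S \<union> T) - S"
    by blast
  then have "T = {b..<b + (p + q)} - {b..<b + p}"
    using ST S by simp
  then have "T = {b + p..<b + p + q}"
    by auto
  ultimately show "S = {b..<b + p} \<and> T = {b + p..<b + p + q}" ..
qed auto

section \<open>The series \<open>\<phi>\<close> and the coefficients of \<open>f\<close>\<close>

text \<open>This is \<open>\<phi>\<close> of the overview, obtained by solving
  \<open>f = 1 + y * (1 + f)\<close> for \<open>f\<close>.\<close>

definition cayley :: "real fps" where
  "cayley = (1 + fps_X) * inverse (1 - fps_X)"

lemma cayley_mult: "(1 - fps_X) * cayley = 1 + fps_X"
proof -
  have "(1 - fps_X) * inverse (1 - fps_X) = (1 :: real fps)"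
    by (rule inverse_mult_eq_1') simp
  then show ?thesis
    by (simp add: cayley_def mult.left_commute)
qed

lemma cayley_nth_0: "cayley $ 0 = 1"
  by (simp add: cayley_def)

lemma cayley_power_nth:
  "cayley ^ Suc N $ n = (\<Sum>v = 0..n. real (Suc N choose (n - v)) * real ((N + v) choose v))"
proof -
  have geom: "inverse (1 - fps_X) ^ Suc N = (Abs_fps (\<lambda>v. real ((N + v) choose v)) :: real fps)"
    using one_minus_const_fps_X_neg_power'[of "Suc N" "1 :: real"]
    by (simp add: fps_inverse_power del: power_Suc)
  \<comment> \<open>The order of the factors makes \<open>v\<close> the exponent taken from the
    negative power of \<open>1 - fps_X\<close>.\<close>
  have "cayley ^ Suc N = Abs_fps (\<lambda>v. real ((N + v) choose v)) * fps_binomial (of_nat (Suc N))"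
    unfolding cayley_def power_mult_distrib geom fps_binomial_of_nat by (rule mult.commute)
  then show ?thesis
    unfolding fps_mult_nth
    by (simp only: fps_mult_nth fps_nth_Abs_fps fps_binomial_nth binomial_gbinomial) (simp only: mult.commute)
qed

lemma cayley_power_rec:
  "cayley ^ Suc N $ Suc n = cayley ^ Suc N $ n + cayley ^ N $ Suc n + cayley ^ N $ n"
proof -
  have "(1 - fps_X) * cayley ^ Suc N = (1 + fps_X) * cayley ^ N"
    by (simp add: cayley_mult flip: mult.assoc)
  from arg_cong[OF this, of "\<lambda>f. f $ Suc n"] show ?thesis
    by (simp add: algebra_simps)
qed

text \<open>Both derivatives contain \<open>fps_deriv cayley * cayley ^ (N - 1)\<close>;
  \<open>cayley_mult\<close> trades \<open>(1 - fps_X) * cayley\<close> for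
  \<open>1 + fps_X\<close>. Then coefficients are compared.\<close>

lemma cayley_power_deriv_rec:
  assumes "N > 0"
  shows "real N * (real (Suc n) * cayley ^ Suc N $ Suc n - real n * cayley ^ Suc N $ n) =
    real (Suc N) * (real (Suc n) * cayley ^ N $ Suc n + real n * cayley ^ N $ n)"
proof -
  obtain M where N: "N = Suc M"
    using assms gr0_implies_Suc by blast
  have shift: "(fps_X * fps_deriv f) $ n = real n * f $ n" for f :: "real fps"
    by (cases n) auto
  have "of_nat N * ((1 - fps_X) * fps_deriv (cayley ^ Suc N)) =
      of_nat N * of_nat (Suc N) * fps_deriv cayley * cayley ^ M * ((1 - fps_X) * cayley)"
    unfolding fps_deriv_power' by (simp add: N algebra_simps)
  also have "\<dots> = of_nat (Suc N) * ((1 + fps_X) * fps_deriv (cayley ^ N))"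
    unfolding cayley_mult fps_deriv_power' by (simp add: N algebra_simps)
  finally have eq: "of_nat N * ((1 - fps_X) * fps_deriv (cayley ^ Suc N)) =
    of_nat (Suc N) * ((1 + fps_X) * fps_deriv (cayley ^ N))" .
  have "real N * (((1 - fps_X) * fps_deriv (cayley ^ Suc N)) $ n) =
    real (Suc N) * (((1 + fps_X) * fps_deriv (cayley ^ N)) $ n)"
    using arg_cong[OF eq, of "\<lambda>f. f $ n"] by (simp add: fps_mult_of_nat_nth del: of_nat_Suc power_Suc)
  then show ?thesis
    unfolding left_diff_distrib distrib_right fps_sub_nth fps_add_nth shift
    by (simp del: of_nat_Suc power_Suc)
qed

text \<open>The two recurrences for \<^const>\<open>cayley\<close> turn the statement into the coefficient form of
  \<open>f ^ Suc m = f ^ m + fps_X * (f ^ (m + 3) + f ^ (m + 4))\<close>, so that a double induction replaces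
  Lagrange inversion. Dividing by \<open>3 * n + m\<close> would give \<open>0 / 0\<close> for \<open>m = n = 0\<close>.\<close>

lemma power_nth_conv_cayley:
  fixes f :: "real fps"
  assumes f: "f = 1 + fps_X * f ^ 3 * (1 + f)"
  shows "real (3 * n + m) * (f ^ m $ n) = real m * cayley ^ (3 * n + m) $ n"
proof (induction n arbitrary: m)
  case 0
  have "f $ 0 = 1"
    by (subst f) simp
  then show ?case
    by (simp add: fps_nth_power_0 cayley_nth_0)
next
  case (Suc n)
  note outer = Suc.IH
  show ?case
  proof (induction m)
    case 0
    then show ?case by simp
  next
    case (Suc m)
    have "f ^ Suc m = f ^ m * (1 + fps_X * f ^ 3 * (1 + f))"
      using f by (metis power_Suc2)
    also have "\<dots> = f ^ m + fps_X * (f ^ (m + 3) + f ^ (m + 4))"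
      by (simp add: algebra_simps power_add eval_nat_numeral)
    finally have step: "f ^ Suc m $ Suc n = f ^ m $ Suc n + f ^ (m + 3) $ n + f ^ (m + 4) $ n"
      by simp
    \<comment> \<open>The inner hypothesis at \<open>m\<close> and the outer one at
      \<open>m + 3\<close> both involve the exponent \<open>N\<close>; the outer one at
      \<open>m + 4\<close> and the goal involve \<open>Suc N\<close>.\<close>
    define N where "N = 3 * Suc n + m"
    have idx: "3 * n + (m + 3) = N" "3 * n + (m + 4) = Suc N" "3 * Suc n + Suc m = Suc N"
      by (simp_all add: N_def)
    have N: "real N = 3 * real n + 3 + real m" "real N > 0"
      by (simp_all add: N_def)
    define a b c d where "a = cayley ^ Suc N $ Suc n" and "b = cayley ^ Suc N $ n"
      and "c = cayley ^ N $ Suc n" and "d = cayley ^ N $ n"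
    define p q r where "p = f ^ m $ Suc n" and "q = f ^ (m + 3) $ n" and "r = f ^ (m + 4) $ n"
    have ih: "real N * p = real m * c" "real N * q = (real m + 3) * d"
      "(real N + 1) * r = (real m + 4) * b"
      using Suc outer[of "m + 3"] outer[of "m + 4"] unfolding idx N_def[symmetric]
      by (simp_all add: p_def q_def r_def b_def c_def d_def add_ac)
    have "a = b + c + d"
      unfolding a_def b_def c_def d_def by (rule cayley_power_rec)
    moreover have "real N * ((real n + 1) * a - real n * b) =
        (real N + 1) * ((real n + 1) * c + real n * d)"
      using cayley_power_deriv_rec[of N n] N(2)
      by (simp add: a_def b_def c_def d_def add_ac del: power_Suc)
    \<comment> \<open>All relations are linear in \<open>a\<close>, \<open>b\<close>,
      \<open>c\<close>, \<open>d\<close>. After eliminating \<open>b\<close> and \<open>a\<close>,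
      the coefficients of \<open>c\<close> and \<open>d\<close> vanish because
      \<open>N = 3 * n + 3 + m\<close>.\<close>
    ultimately have "real N * ((real N + 1) * (p + q + r)) = real N * ((real m + 1) * a)"
      using ih N(1) by algebra
    then have "(real N + 1) * (p + q + r) = (real m + 1) * a"
      using N(2) by simp
    then show ?case
      unfolding idx step by (simp add: a_def p_def q_def r_def add_ac del: power_Suc)
  qed
qed

text \<open>With \<open>f = 1 + u\<close> the equation becomes
  \<open>u = fps_X * (1 + u) ^ 3 * (2 + u)\<close>, so \<open>u\<close> is the compositional inverse
  of \<open>\<psi>\<close>, whose linear coefficient is nonzero.\<close>

lemma ex_fps_fixpoint: "\<exists>f :: real fps. f = 1 + fps_X * f ^ 3 * (1 + f)"
proof -
  define \<psi> :: "real fps" where "\<psi> = fps_X * inverse ((1 + fps_X) ^ 3 * (2 + fps_X))"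
  define u where "u = fps_inv \<psi>"
  have u0: "u $ 0 = 0"
    by (simp add: u_def fps_inv_def)
  have "\<psi> $ 0 = 0" "\<psi> $ 1 \<noteq> 0"
    by (simp_all add: \<psi>_def fps_nth_power_0)
  then have inv: "\<psi> oo u = fps_X"
    unfolding u_def by (rule fps_inv_right)
  have "\<psi> * ((1 + fps_X) ^ 3 * (2 + fps_X)) = fps_X"
    unfolding \<psi>_def mult.assoc by (subst inverse_mult_eq_1) (simp_all add: fps_nth_power_0)
  then have "fps_X oo u = (\<psi> * ((1 + fps_X) ^ 3 * (2 + fps_X))) oo u"
    by simp
  also have "\<dots> = fps_X * ((1 + u) ^ 3 * (2 + u))"
    using u0 by (simp add: fps_compose_mult_distrib inv fps_compose_add_distrib
        flip: fps_compose_power)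
  finally have "u = fps_X * ((1 + u) ^ 3 * (2 + u))"
    using u0 by simp
  then have "1 + u = 1 + fps_X * (1 + u) ^ 3 * (1 + (1 + u))"
    by (simp add: add_ac mult_ac)
  then show ?thesis by blast
qed

section \<open>Recurrences of the three generating functions\<close>

definition free_heads_fps :: "real fps \<Rightarrow> nat \<Rightarrow> real fps" where
  "free_heads_fps f k = (if k = 0 then f else if k = 1 then f ^ 2 else f ^ 3 + f ^ 2)"

lemma fps_X_mult_prod_nth:
  "(fps_X * (a * b)) $ n = (\<Sum>i<n. a $ i * b $ (n - 1 - i))" for a b :: "real fps"
  unfolding fps_X_mult_nth by (cases n) (simp_all add: fps_mult_nth atLeast0AtMost lessThan_Suc_atMost)

context
  fixes f :: "real fps"
  assumes f: "f = 1 + fps_X * f ^ 3 * (1 + f)"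
begin

private abbreviation g where "g \<equiv> free_heads_fps f"

text \<open>Multiplying the equation for \<open>f\<close> by \<open>f ^ j\<close> gives
  \<open>step\<close>. Its cases \<open>j = 0\<close> and \<open>j = 1\<close> are the first two
  recurrences; the sum of \<open>j = 1\<close> and \<open>j = 2\<close> is the third.\<close>

lemma free_heads_fps_rec:
  "g 0 = 1 + fps_X * (g 0 * g 2)"
  "g 1 = g 0 + fps_X * (g 1 * g 2)"
  "g 2 = g 1 + g 0 + fps_X * (g 2 * g 2)"
proof -
  have step: "f ^ Suc j = f ^ j + fps_X * (f ^ j * (f ^ 3 + f ^ 4))" for j
  proof -
    have "f ^ Suc j = f ^ j * (1 + fps_X * f ^ 3 * (1 + f))"
      using f by (metis power_Suc2)
    then show ?thesis
      by (simp add: algebra_simps eval_nat_numeral)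
  qed
  show "g 0 = 1 + fps_X * (g 0 * g 2)" "g 1 = g 0 + fps_X * (g 1 * g 2)"
    using step[of 0] step[of 1] by (simp_all add: free_heads_fps_def algebra_simps eval_nat_numeral)
  show "g 2 = g 1 + g 0 + fps_X * (g 2 * g 2)"
    using step[of 1] step[of 2] unfolding free_heads_fps_def by simp algebra
qed

lemma free_heads_fps_nth_0: "g 0 $ 0 = 1" "g 1 $ 0 = 1"
proof -
  show "g 0 $ 0 = 1"
    by (subst free_heads_fps_rec(1)) simp
  then show "g 1 $ 0 = 1"
    by (subst free_heads_fps_rec(2)) simp
qed

lemma free_heads_fps_nth:
  "g 0 $ Suc n = (\<Sum>i\<le>n. g 0 $ i * g 2 $ (n - i))"
  "g 1 $ n = g 0 $ n + (\<Sum>i<n. g 1 $ i * g 2 $ (n - 1 - i))"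
  "g 2 $ n = g 1 $ n + g 0 $ n + (\<Sum>i<n. g 2 $ i * g 2 $ (n - 1 - i))"
proof -
  show "g 0 $ Suc n = (\<Sum>i\<le>n. g 0 $ i * g 2 $ (n - i))"
    using arg_cong[OF free_heads_fps_rec(1), of "\<lambda>h. h $ Suc n"]
    unfolding fps_add_nth fps_X_mult_prod_nth by (simp add: lessThan_Suc_atMost)
  show "g 1 $ n = g 0 $ n + (\<Sum>i<n. g 1 $ i * g 2 $ (n - 1 - i))"
    using arg_cong[OF free_heads_fps_rec(2), of "\<lambda>h. h $ n"]
    unfolding fps_add_nth fps_X_mult_prod_nth .
  show "g 2 $ n = g 1 $ n + g 0 $ n + (\<Sum>i<n. g 2 $ i * g 2 $ (n - 1 - i))"
    using arg_cong[OF free_heads_fps_rec(3), of "\<lambda>h. h $ n"]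
    unfolding fps_add_nth fps_X_mult_prod_nth .
qed

end

section \<open>Counting words with free initial letters\<close>

text \<open>Recognizes the block heads behind \<open>c\<close> free letters: \<open>l\<close> counts
  the letters between these and the minimum.\<close>

lemma add_mem_image_3_iff:
  "l + c \<in> (\<lambda>i. 3 * i + c) ` {..<n} \<longleftrightarrow> l mod 3 = 0 \<and> l < 3 * n" for l c n :: nat
proof
  assume "l mod 3 = 0 \<and> l < 3 * n"
  then have "l = 3 * (l div 3)" "l div 3 < n"
    by auto
  then show "l + c \<in> (\<lambda>i. 3 * i + c) ` {..<n}"
    by (metis image_eqI lessThan_iff)
qed auto

context min_split
begin

text \<open>The first \<open>k\<close> letters are unconstrained: these words arise to the right of the minimum,
  which removes the head of the block it lies in.\<close>

lemma card_words_heads_min: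
  fixes f :: "real fps"
  assumes f: "f = 1 + fps_X * f ^ 3 * (1 + f)" and "k < 3"
  shows "real (card (words b (k + 3 * n) (\<lambda>w. heads_min (drop k w)))) = free_heads_fps f k $ n"
  using \<open>k < 3\<close>
\<comment> \<open>The induction is on word length because the two parts change both \<open>k\<close>
  and \<open>n\<close>.\<close>
proof (induction "k + 3 * n" arbitrary: k n b rule: less_induct)
  case less
  let ?H = "\<lambda>k w. heads_min (drop k w)"
  let ?g = "free_heads_fps f"
  have IH: "real (card (words s m (?H j))) = ?g j $ i"
    if "m = j + 3 * i" "j < 3" "m < k + 3 * n" for s m j i
    using less.hyps[of j i s] that by blast
  have div_3: "3 * i div 3 = i" "(3 * i + 1) div 3 = i" "(3 * i + 2) div 3 = i" for i :: nat
    by presburger+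
  consider "k = 0" "n = 0" | n' where "k = 0" "n = Suc n'" | "k = 1" | "k = 2"
    using less.prems by (cases n) (auto simp: less_Suc_eq eval_nat_numeral)
  then show ?case
  proof cases
    case 1
    then show ?thesis
      using free_heads_fps_nth_0(1)[OF f] by (simp add: card_words_0)
  next
    case 2
    \<comment> \<open>Without free letters the minimum heads a block: \<open>A\<close> has none
      either, and \<open>B\<close> starts with the two freed ones.\<close>
    let ?J = "(\<lambda>i. 3 * i + 0) ` {..<Suc n'}"
    have "real (card (words b (Suc (2 + 3 * n')) (?H 0))) =
        (\<Sum>p\<in>?J. ?g 0 $ (p div 3) * ?g 2 $ (n' - p div 3))"
    proof (rule card_words_Suc[where QA = "\<lambda>_. ?H 0" and QB = "\<lambda>_. ?H 2"])
      show "?J \<subseteq> {..2 + 3 * n'}"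
        by auto
      fix A B :: "nat list"
      assume min: "\<forall>y\<in>set A \<union> set B. b < y" and len: "length A + length B = 2 + 3 * n'"
      have "(length A + length B) mod 3 = 2"
        unfolding len by presburger
      moreover have "length A \<in> ?J \<longleftrightarrow> length A mod 3 = 0"
        using add_mem_image_3_iff[of "length A" 0 "Suc n'"] len by auto
      ultimately show "?H 0 (A @ b # B) \<longleftrightarrow> length A \<in> ?J \<and> ?H 0 A \<and> ?H 2 B"
        using heads_min_append_Cons[OF min] by simp
    next
      fix p s assume "p \<in> ?J"
      then obtain i where i: "p = 3 * i" "i \<le> n'"
        by auto
      then have *: "2 + 3 * n' - p = 2 + 3 * (n' - i)" "p div 3 = i"
        by simp_all
      show "real (card (words s p (?H 0))) = ?g 0 $ (p div 3)"
        unfolding * by (rule IH) (use 2 i in simp_all)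
      show "real (card (words s (2 + 3 * n' - p) (?H 2))) = ?g 2 $ (n' - p div 3)"
        unfolding * by (rule IH) (use 2 i in simp_all)
    qed
    also have "\<dots> = ?g 0 $ n"
      unfolding 2(2) free_heads_fps_nth(1)[OF f] by (subst sum.reindex)
        (simp_all add: inj_on_def lessThan_Suc_atMost)
    finally have "real (card (words b (Suc (2 + 3 * n')) (?H 0))) = ?g 0 $ n" .
    moreover have "k + 3 * n = Suc (2 + 3 * n')"
      using 2 by simp
    ultimately show ?thesis
      using 2(1) by (simp only:)
  next
    case 3
    \<comment> \<open>At position 0 the minimum is the free letter itself and \<open>B\<close> has
      none. At \<open>3 * i + 1\<close> it heads a block, and \<open>A\<close> keeps the free
      letter.\<close>
    let ?J = "(\<lambda>i. 3 * i + 1) ` {..<n}"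
    let ?QA = "\<lambda>p. if p = 0 then ?H 0 else ?H 1"
    let ?QB = "\<lambda>p. if p = 0 then ?H 0 else ?H 2"
    let ?u = "\<lambda>p. if p = 0 then 1 else ?g 1 $ (p div 3)"
    let ?v = "\<lambda>p. if p = 0 then ?g 0 $ n else ?g 2 $ (n - 1 - p div 3)"
    have "real (card (words b (Suc (3 * n)) (?H 1))) = (\<Sum>p\<in>insert 0 ?J. ?u p * ?v p)"
    proof (rule card_words_Suc[where QA = ?QA and QB = ?QB])
      show "insert 0 ?J \<subseteq> {..3 * n}"
        by auto
      fix A B :: "nat list"
      assume min: "\<forall>y\<in>set A \<union> set B. b < y" and len: "length A + length B = 3 * n"
      show "?H 1 (A @ b # B) \<longleftrightarrow>
        length A \<in> insert 0 ?J \<and> ?QA (length A) A \<and> ?QB (length A) B"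
      proof (cases A)
        case Nil
        then show ?thesis by simp
      next
        case (Cons a A')
        have "(length A' + length B) mod 3 = 2"
          using len unfolding Cons list.size by presburger
        moreover have "\<forall>y\<in>set A' \<union> set B. b < y"
          using min Cons by simp
        ultimately have "?H 1 (A @ b # B) \<longleftrightarrow> length A' mod 3 = 0 \<and> ?H 1 A \<and> ?H 2 B"
          using Cons heads_min_append_Cons[of A' B b] by simp
        moreover have "length A \<in> ?J \<longleftrightarrow> length A' mod 3 = 0"
          using add_mem_image_3_iff[of "length A'" 1 n] len Cons by simp
        moreover have "length A \<noteq> 0"
          using Cons by simp
        ultimately show ?thesis
          by (simp only: insert_iff if_False simp_thms)
      qed
    next
      fix p s assume "p \<in> insert 0 ?J"
      then consider "p = 0" | i where "p = 3 * i + 1" "i < n"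
        by blast
      then show "real (card (words s p (?QA p))) = ?u p"
      proof cases
        case 1
        then show ?thesis
          by (simp add: card_words_0)
      next
        case (2 i)
        then show ?thesis
          using 3 IH[of p 1 i s] by (simp add: div_3[simplified])
      qed
    next
      fix p s assume "p \<in> insert 0 ?J"
      then consider "p = 0" | i where "p = 3 * i + 1" "i < n"
        by blast
      then show "real (card (words s (3 * n - p) (?QB p))) = ?v p"
      proof cases
        case 1
        then show ?thesis
          using 3 IH[of "3 * n" 0 n s] by simp
      next
        case (2 i)
        then have "3 * n - p = 2 + 3 * (n - 1 - i)"
          by auto
        then show ?thesis
          using 2 3 IH[of "3 * n - p" 2 "n - 1 - i" s] by (simp add: div_3[simplified])
      qed
    qed
    also have "\<dots> = ?g 0 $ n + (\<Sum>p\<in>?J. ?u p * ?v p)"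
      by (subst sum.insert) auto
    also have "(\<Sum>p\<in>?J. ?u p * ?v p) = (\<Sum>i<n. ?g 1 $ i * ?g 2 $ (n - 1 - i))"
      by (subst sum.reindex) (simp_all add: inj_on_def div_3[simplified])
    also note free_heads_fps_nth(2)[OF f, symmetric]
    finally show ?thesis
      using 3 by simp
  next
    case 4
    \<comment> \<open>A minimum at position 0 leaves one free letter to \<open>B\<close>; at
      position 1, one to \<open>A\<close> and none to \<open>B\<close>. At \<open>3 * i + 2\<close>,
      \<open>A\<close> keeps both and \<open>B\<close> gains two.\<close>
    let ?J = "(\<lambda>i. 3 * i + 2) ` {..<n}"
    let ?QA = "\<lambda>p. if p = 0 then ?H 0 else if p = 1 then ?H 1 else ?H 2"
    let ?QB = "\<lambda>p. if p = 0 then ?H 1 else if p = 1 then ?H 0 else ?H 2"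
    let ?u = "\<lambda>p. if p \<le> 1 then 1 else ?g 2 $ (p div 3)"
    let ?v = "\<lambda>p. if p = 0 then ?g 1 $ n else if p = 1 then ?g 0 $ n else ?g 2 $ (n - 1 - p div 3)"
    have "real (card (words b (Suc (1 + 3 * n)) (?H 2))) =
        (\<Sum>p\<in>insert 0 (insert 1 ?J). ?u p * ?v p)"
    proof (rule card_words_Suc[where QA = ?QA and QB = ?QB])
      show "insert 0 (insert 1 ?J) \<subseteq> {..1 + 3 * n}"
        by auto
      fix A B :: "nat list"
      assume min: "\<forall>y\<in>set A \<union> set B. b < y" and len: "length A + length B = 1 + 3 * n"
      consider "A = []" | a where "A = [a]" | a c A' where "A = a # c # A'"
        by (metis list.exhaust)
      then show "?H 2 (A @ b # B) \<longleftrightarrow>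
        length A \<in> insert 0 (insert 1 ?J) \<and> ?QA (length A) A \<and> ?QB (length A) B"
      proof cases
        case 1
        then show ?thesis
          by (simp add: eval_nat_numeral)
      next
        case (2 a)
        then show ?thesis
          by (simp add: eval_nat_numeral)
      next
        case (3 a c A')
        have "(length A' + length B) mod 3 = 2"
          using len unfolding 3 list.size by presburger
        moreover have "\<forall>y\<in>set A' \<union> set B. b < y"
          using min 3 by simp
        ultimately have "?H 2 (A @ b # B) \<longleftrightarrow> length A' mod 3 = 0 \<and> ?H 2 A \<and> ?H 2 B"
          using 3 heads_min_append_Cons[of A' B b] by simp
        moreover have "length A \<in> ?J \<longleftrightarrow> length A' mod 3 = 0"
          using add_mem_image_3_iff[of "length A'" 2 n] len 3 by simp
        moreover have "length A \<noteq> 0" "length A \<noteq> 1"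
          using 3 by simp_all
        ultimately show ?thesis
          by (simp only: insert_iff if_False simp_thms)
      qed
    next
      fix p s assume "p \<in> insert 0 (insert 1 ?J)"
      then consider "p = 0" | "p = 1" | i where "p = 3 * i + 2" "i < n"
        by blast
      then show "real (card (words s p (?QA p))) = ?u p"
      proof cases
        case 1
        then show ?thesis
          by (simp add: card_words_0)
      next
        case 2
        then show ?thesis
          using 4 IH[of 1 1 0 s] free_heads_fps_nth_0(2)[OF f] by simp
      next
        case (3 i)
        then show ?thesis
          using 4 IH[of p 2 i s] by (simp add: div_3[simplified])
      qed
    next
      fix p s assume "p \<in> insert 0 (insert 1 ?J)"
      then consider "p = 0" | "p = 1" | i where "p = 3 * i + 2" "i < n"
        by blast
      then show "real (card (words s (1 + 3 * n - p) (?QB p))) = ?v p"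
      proof cases
        case 1
        then show ?thesis
          using 4 IH[of "1 + 3 * n" 1 n s] by simp
      next
        case 2
        then show ?thesis
          using 4 IH[of "3 * n" 0 n s] by simp
      next
        case (3 i)
        then have "1 + 3 * n - p = 2 + 3 * (n - 1 - i)"
          by auto
        then show ?thesis
          using 3 4 IH[of "1 + 3 * n - p" 2 "n - 1 - i" s] by (simp add: div_3[simplified])
      qed
    qed
    also have "\<dots> = ?g 1 $ n + (?g 0 $ n + (\<Sum>p\<in>?J. ?u p * ?v p))"
      by (subst sum.insert, force, force, subst sum.insert) auto
    also have "(\<Sum>p\<in>?J. ?u p * ?v p) = (\<Sum>i<n. ?g 2 $ i * ?g 2 $ (n - 1 - i))"
      by (subst sum.reindex) (simp_all add: inj_on_def div_3[simplified])
    also note add.assoc[symmetric]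
    also note free_heads_fps_nth(3)[OF f, symmetric]
    finally show ?thesis
      using 4 by simp
  qed
qed

text \<open>Combines the count for \<open>k = 0\<close> with the power formula at exponent
  \<open>m = 1\<close>.\<close>

lemma card_words_conv_cayley:
  "real (card (words b (3 * n) heads_min)) = 1 / (3 * real n + 1) * cayley ^ Suc (3 * n) $ n"
proof -
  obtain f :: "real fps" where f: "f = 1 + fps_X * f ^ 3 * (1 + f)"
    using ex_fps_fixpoint by blast
  have "real (card (words b (3 * n) heads_min)) = f $ n"
    using card_words_heads_min[OF f, of 0 b n] by (simp add: free_heads_fps_def)
  moreover have "(3 * real n + 1) * f $ n = cayley ^ Suc (3 * n) $ n"
    using power_nth_conv_cayley[OF f, of n 1] by (simp add: add.commute)
  moreover have "3 * real n + 1 \<noteq> 0"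
    by linarith
  ultimately show ?thesis
    by (simp add: nonzero_eq_divide_eq mult.commute del: power_Suc)
qed

end

section \<open>The two patterns\<close>

lemma S2_conv_words:
  assumes "min_split (\<lambda>w. avoids_pattern w \<sigma>) R"
  shows "S2 n {\<sigma>} = min_split.words (\<lambda>w. avoids_pattern w \<sigma>) 1 (3 * n) heads_min"
proof -
  have "length w = 3 * n" if "w \<in> permutations_of_set {1..3 * n}" for w
    using that length_finite_permutations_of_set[of w] by fastforce
  moreover have "{1..3 * n} = {1..<1 + 3 * n}"
    by auto
  ultimately show ?thesis
    unfolding S2_def min_split.words_def[OF assms] by (auto simp: heads_min_conv_nth)
qed

lemma min_split_213: "min_split (\<lambda>w. avoids_pattern w [2, 1, 3]) (\<lambda>a c. c < a)"
proof
  fix b p q :: nat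
  \<comment> \<open>Here \<open>T\<close> is the lower part, so the roles of \<open>S\<close> and
    \<open>T\<close> are exchanged.\<close>
  have "S \<union> T = {b..<b + (p + q)} \<and> card S = p \<and> card T = q \<and> (\<forall>a\<in>S. \<forall>c\<in>T. c < a) \<longleftrightarrow>
      S = {b + q..<b + q + p} \<and> T = {b..<b + q}" for S T
    using lower_part_of_interval[of T S b q p] by (auto simp: Un_commute add.commute)
  then show "\<exists>s t. \<forall>S T. S \<union> T = {b..<b + (p + q)} \<and> card S = p \<and> card T = q \<and>
      (\<forall>a\<in>S. \<forall>c\<in>T. c < a) \<longleftrightarrow> S = {s..<s + p} \<and> T = {t..<t + q}"
    by blast
qed (simp add: avoids_213 del: One_nat_def, rule avoids_213_split)

lemma min_split_312: "min_split (\<lambda>w. avoids_pattern w [3, 1, 2]) (\<lambda>a c. a < c)"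
proof
  fix b p q :: nat
  show "\<exists>s t. \<forall>S T. S \<union> T = {b..<b + (p + q)} \<and> card S = p \<and> card T = q \<and>
      (\<forall>a\<in>S. \<forall>c\<in>T. a < c) \<longleftrightarrow> S = {s..<s + p} \<and> T = {t..<t + q}"
    by (rule exI[of _ b], rule exI[of _ "b + p"]) (intro allI lower_part_of_interval)
qed (simp add: avoids_312 del: One_nat_def, rule avoids_312_split)

theorem theorem13:
  fixes n :: nat
  shows "card (S2 n {[2, 1, 3]}) = card (S2 n {[3, 1, 2]}) \<and>
         real (card (S2 n {[3, 1, 2]})) =
           1 / (3 * real n + 1) *
           (\<Sum>v = 0..n. real ((3 * n + 1) choose (n - v)) * real ((3 * n + v) choose v))"
proof -
  \<comment> \<open>One formula covers every pattern that splits this way, so equality of the two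
    counts follows without a bijection.\<close>
  have "real (card (S2 n {\<sigma>})) = 1 / (3 * real n + 1) *
      (\<Sum>v = 0..n. real ((3 * n + 1) choose (n - v)) * real ((3 * n + v) choose v))"
    if "min_split (\<lambda>w. avoids_pattern w \<sigma>) R" for \<sigma> R
    unfolding S2_conv_words[OF that] min_split.card_words_conv_cayley[OF that] cayley_power_nth
    by simp
  from this[OF min_split_213] this[OF min_split_312] show ?thesis
    by simp
qed

end
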